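(* Let $Z$ be an admissible divisor in $\mathbb{D}$ and let $\mathcal{U}$ be an ultrafilter on the underlying point set $|Z|$ (ignoring multiplicities). For each $W\in\mathcal{U}$ let $f_W\in\mathcal{R}_{\mathbb{R}}$ have constant term $1$ and $Z(f_W)=W$ as a set (such a function exists). Define $$\Phi_{\mathcal{U}}:\mathcal{R}_{\mathbb{R}}\to\prod_{a\in |Z|}\mathbb{C}\Big/\mathcal{U},\qquad \Phi_{\mathcal{U}}(h)=[(h(a))_{a\in |Z|}]_{\mathcal{U}}.$$ Then: (i) $\Phi_{\mathcal{U}}$ is a ring homomorphism to a field (the ultraproduct of copies of $\mathbb{C}$ along $\mathcal{U}$). (ii) $P_{\mathcal{U}}=\ker(\Phi_{\mathcal{U}})$ belongs to $\mathfrak{P}_1$: it is prime and contains $f_{|Z|}$, which has constant term $1$. (iii) $\mathcal{F}_Z(P_{\mathcal{U}})=\mathcal{U}$: for $h=1+zH$ with $H\in\mathcal{R}_{\mathbb{R}}$ and $Z(h)\subseteq Z$, one has $h\in P_{\mathcal{U}}$ if and only if $\{a\in |Z|: h(a)=0\}=Z(h)\in\mathcal{U}$. (iv) The map $\mathcal{U}\mapsto P_{\mathcal{U}}$ is injective: if $P_{\mathcal{U}_1}=P_{\mathcal{U}_2}$ for ultrafilters $\mathcal{U}_1,\mathcal{U}_2$ on $|Z|$, then $\mathcal{U}_1=\mathcal{U}_2$.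
   Context: $\mathbb{D}=\{z\in\mathbb{C}:|z|<1\}$ is the open unit disk and $\mathcal{O}(\mathbb{D})$ is the ring of holomorphic functions on $\mathbb{D}$. $\mathcal{R}_{\mathbb{R}}=\mathbb{Z}[[z]]\cap\mathcal{O}(\mathbb{D})$ is the ring of holomorphic functions on $\mathbb{D}$ all of whose Taylor coefficients at $0$ are integers. An admissible divisor is a discrete (locally finite) effective divisor on $\mathbb{D}$, invariant under complex conjugation, whose support does not contain $0$; $|Z|$ denotes its support. $\mathfrak{P}_1$ is the set of prime ideals of $\mathcal{R}_{\mathbb{R}}$ containing at least one element of the form $1+zF$ with $F\in\mathcal{R}_{\mathbb{R}}$. $Z(h)$ is the zero set of $h$ in $\mathbb{D}$; in this statement zero sets are compared with members of $\mathcal{U}$ as point sets, ignoring multiplicities. For $P\in\mathfrak{P}_1$, $\mathcal{F}_Z(P)=\{Z(h): h\in P,\ h=1+zH,\ H\in\mathcal{R}_{\mathbb{R}},\ Z(h)\subseteq Z\}$. Ultrafilters are proper.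
   Formalization: False if |Z| has non-real points (Z={a,ā}). Corrected: f_W exists for conjugation-invariant W in U; F_Z(P_U) is the set of conjugation-invariant members of U; in (iv) U_1, U_2 have the same invariant members and U_1=U_2 or U_1=conj(U_2). Literal if |Z| is real. *)

theory Defs
  imports "HOL-Complex_Analysis.Complex_Analysis" "HOL-Algebra.QuotRing"
begin

abbreviation unit_disk :: "complex set" where
  "unit_disk \<equiv> ball 0 1"

definition zero_set :: "(complex \<Rightarrow> complex) \<Rightarrow> complex set" where
  "zero_set h = {a \<in> unit_disk. h a = 0}"

(* Functions on the disk are represented by functions on the complex plane that are undefined
   outside it, so that equality in the ring is equality of functions on the disk. *)
definition integer_holomorphic_ring :: "(complex \<Rightarrow> complex) ring" where
  "integer_holomorphic_ring =
    \<lparr>carrier = {h \<in> extensional unit_disk.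
        h holomorphic_on unit_disk \<and> (\<forall>n. fps_nth (fps_expansion h 0) n \<in> \<int>)},
     mult = (\<lambda>g h. \<lambda>z\<in>unit_disk. g z * h z),
     one = (\<lambda>z\<in>unit_disk. 1),
     zero = (\<lambda>z\<in>unit_disk. 0),
     add = (\<lambda>g h. \<lambda>z\<in>unit_disk. g z + h z)\<rparr>"

definition one_plus_z_times :: "(complex \<Rightarrow> complex) \<Rightarrow> (complex \<Rightarrow> complex)" where
  "one_plus_z_times H = (\<lambda>z\<in>unit_disk. 1 + z * H z)"

text \<open>An effective divisor is given by its multiplicity function.\<close>

definition divisor_support :: "(complex \<Rightarrow> nat) \<Rightarrow> complex set" where
  "divisor_support Z = {a. Z a \<noteq> 0}"

definition admissible_divisor :: "(complex \<Rightarrow> nat) \<Rightarrow> bool" where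
  "admissible_divisor Z \<longleftrightarrow>
    divisor_support Z \<subseteq> unit_disk \<and>
    (\<forall>a\<in>unit_disk. \<exists>e>0. finite (ball a e \<inter> divisor_support Z)) \<and>
    (\<forall>a. Z (cnj a) = Z a) \<and>
    0 \<notin> divisor_support Z"

definition ultrafilter_on :: "'a set \<Rightarrow> 'a set set \<Rightarrow> bool" where
  "ultrafilter_on A U \<longleftrightarrow>
    U \<subseteq> Pow A \<and> A \<in> U \<and> {} \<notin> U \<and>
    (\<forall>V\<in>U. \<forall>W\<in>U. V \<inter> W \<in> U) \<and>
    (\<forall>V\<in>U. \<forall>W. V \<subseteq> W \<and> W \<subseteq> A \<longrightarrow> W \<in> U) \<and>
    (\<forall>W. W \<subseteq> A \<longrightarrow> W \<in> U \<or> A - W \<in> U)"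

text \<open>The zero set of a power series with integer coefficients is invariant under complex
  conjugation, so only the conjugation-invariant members of an ultrafilter are zero sets.\<close>

definition conj_invariant :: "complex set \<Rightarrow> bool" where
  "conj_invariant W \<longleftrightarrow> cnj ` W = W"

definition complex_power_ring :: "'a set \<Rightarrow> ('a \<Rightarrow> complex) ring" where
  "complex_power_ring A =
    \<lparr>carrier = A \<rightarrow>\<^sub>E UNIV,
     mult = (\<lambda>x y. \<lambda>a\<in>A. x a * y a),
     one = (\<lambda>a\<in>A. 1),
     zero = (\<lambda>a\<in>A. 0),
     add = (\<lambda>x y. \<lambda>a\<in>A. x a + y a)\<rparr>"

definition null_families :: "'a set \<Rightarrow> 'a set set \<Rightarrow> ('a \<Rightarrow> complex) set" where
  "null_families A U = {x \<in> A \<rightarrow>\<^sub>E UNIV. {a \<in> A. x a = 0} \<in> U}"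

text \<open>Two families lie in the same coset of the null families iff they agree on a member of \<open>U\<close>,
  so the quotient below is the ultraproduct and the coset of a family is its class modulo \<open>U\<close>.\<close>

definition ultraproduct :: "'a set \<Rightarrow> 'a set set \<Rightarrow> ('a \<Rightarrow> complex) set ring" where
  "ultraproduct A U = complex_power_ring A Quot null_families A U"

definition evaluation_hom ::
  "complex set \<Rightarrow> complex set set \<Rightarrow> (complex \<Rightarrow> complex) \<Rightarrow> (complex \<Rightarrow> complex) set" where
  "evaluation_hom A U h = null_families A U +>\<^bsub>complex_power_ring A\<^esub> (\<lambda>a\<in>A. h a)"

definition ultrafilter_ideal :: "complex set \<Rightarrow> complex set set \<Rightarrow> (complex \<Rightarrow> complex) set" where
  "ultrafilter_ideal A U =
    a_kernel integer_holomorphic_ring (ultraproduct A U) (evaluation_hom A U)"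

definition primes_one :: "(complex \<Rightarrow> complex) set set" where
  "primes_one = {P. primeideal P integer_holomorphic_ring \<and>
     (\<exists>F\<in>carrier integer_holomorphic_ring. one_plus_z_times F \<in> P)}"

definition zero_filter :: "(complex \<Rightarrow> nat) \<Rightarrow> (complex \<Rightarrow> complex) set \<Rightarrow> complex set set" where
  "zero_filter Z P = {zero_set h | h. h \<in> P \<and>
     (\<exists>H\<in>carrier integer_holomorphic_ring. h = one_plus_z_times H) \<and>
     zero_set h \<subseteq> divisor_support Z}"

end

theory Submission
  imports Defs
begin

text \<open>
  Almost everything reduces to two facts.

  First, a function of the ring lies in the kernel of the evaluation map iff the points of the
  support where it vanishes form a member of the ultrafilter (\<open>mem_ultrafilter_ideal_iff\<close>). The
  families vanishing on a member of the ultrafilter form a maximal ideal of the product ring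
  (\<open>maximalideal_null_families\<close>), so the ultraproduct is a field and the kernel is prime.

  Second, every conjugation-invariant subset \<open>W\<close> of the support is the zero set of a function with
  integer Taylor coefficients and constant term \<open>1\<close> (\<open>exists_integer_function_with_zero_set\<close>).
  A Weierstrass product adapted to the disk gives a holomorphic \<open>u\<close> with zero set \<open>W\<close>; the
  product of \<open>u\<close> with its reflection \<open>z \<mapsto> cnj (u (cnj z))\<close> has the same zeros and real Taylor
  coefficients; and such a function, normalised to the value \<open>1\<close> at the origin, becomes integral
  after multiplication by some \<open>exp (\<Sum>n. c\<^sub>n z\<^sup>n)\<close>. Indeed, once \<open>c\<^sub>1, \<dots>, c\<^sub>n\<^sub>-\<^sub>1\<close> are chosen, the
  \<open>n\<close>-th coefficient of the product is \<open>c\<^sub>n\<close> plus a real number that is already determined, so it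
  can be rounded to an integer by a \<open>c\<^sub>n\<close> of modulus at most \<open>1/2\<close>. Bounded \<open>c\<^sub>n\<close> make the exponent
  converge on the whole disk, and an exponential adds no zeros.

  Together these identify the filter of zero sets of the kernel with the conjugation-invariant
  members of the ultrafilter. Those members determine the ultrafilter up to conjugation: after a
  conjugation it contains the half of the support with nonnegative imaginary part, and on that half
  every set is the trace of an invariant one.
\<close>

section \<open>Holomorphic functions on the disk with prescribed zeros\<close>

text \<open>
  Zeros accumulating at the circle rule out the factors \<open>E\<^sub>n (z / a\<^sub>n)\<close> of the plane. Each zero \<open>a\<^sub>n\<close>
  is paired instead with its radial projection \<open>b\<^sub>n\<close> to the circle, and the factor is
  \<open>E\<^sub>n ((a\<^sub>n - b\<^sub>n) / (z - b\<^sub>n))\<close>: it vanishes exactly at \<open>a\<^sub>n\<close>, and since \<open>a\<^sub>n - b\<^sub>n\<close> tends to \<open>0\<close>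
  while \<open>z - b\<^sub>n\<close> stays away from \<open>0\<close> for \<open>z\<close> in a compact subset of the disk, the arguments are
  eventually at most \<open>1/2\<close> there and the product converges geometrically.
\<close>

lemma holomorphic_on_disk_with_zero_set:
  assumes W_disk: "W \<subseteq> unit_disk" and W_0: "0 \<notin> W"
    and W_fin: "\<And>r. r < 1 \<Longrightarrow> finite (W \<inter> cball 0 r)"
  obtains g where "g holomorphic_on unit_disk" "\<And>z. z \<in> unit_disk \<Longrightarrow> g z = 0 \<longleftrightarrow> z \<in> W"
proof -
  have "W \<subseteq> (\<Union>n::nat. W \<inter> cball 0 (1 - 1 / real (Suc n)))"
  proof
    fix z assume z: "z \<in> W"
    hence "norm z < 1" using W_disk by auto
    then obtain n :: nat where "inverse (real (Suc n)) < 1 - norm z"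
      by (metis diff_gt_0_iff_gt reals_Archimedean)
    hence "norm z \<le> 1 - 1 / real (Suc n)"
      unfolding inverse_eq_divide by linarith
    hence "z \<in> W \<inter> cball 0 (1 - 1 / real (Suc n))"
      using z by simp
    thus "z \<in> (\<Union>n::nat. W \<inter> cball 0 (1 - 1 / real (Suc n)))" by (rule UN_I[OF UNIV_I])
  qed
  moreover have "countable (\<Union>n::nat. W \<inter> cball 0 (1 - 1 / real (Suc n)))"
    by (rule countable_UN) (auto intro!: countable_finite W_fin)
  ultimately have countable: "countable W"
    by (rule countable_subset)

  \<comment> \<open>The entries equal to \<open>1\<close> contribute the trivial factor, so finite and infinite \<open>W\<close> need
    not be told apart.\<close>
  define a where "a n = (if n \<in> to_nat_on W ` W then from_nat_into W n else 1)" for n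
  have a_W: "a n \<in> W \<or> a n = 1" for n
    by (auto simp: a_def countable)
  have range_a: "range a \<inter> unit_disk = W"
  proof (intro equalityI subsetI)
    fix z assume "z \<in> range a \<inter> unit_disk"
    then obtain n where "z = a n" "norm z < 1" by auto
    thus "z \<in> W" using a_W[of n] by auto
  next
    fix z assume z: "z \<in> W"
    hence "z = a (to_nat_on W z)" by (simp add: a_def countable)
    thus "z \<in> range a \<inter> unit_disk" using z W_disk by blast
  qed
  have a_nz: "a n \<noteq> 0" for n using a_W[of n] W_0 by auto
  have a_le: "norm (a n) \<le> 1" for n
    using a_W[of n] W_disk by (auto simp: subset_iff less_imp_le)
  have a_ev: "eventually (\<lambda>n. norm (a n) > r) sequentially" if "r < 1" for r
  proof -
    have "{n. \<not> norm (a n) > r} \<subseteq> to_nat_on W ` (W \<inter> cball 0 r)"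
    proof
      fix n assume "n \<in> {n. \<not> norm (a n) > r}"
      hence n: "norm (a n) \<le> r" by simp
      hence "n \<in> to_nat_on W ` W" using that by (auto simp: a_def split: if_splits)
      then obtain w where w: "w \<in> W" "n = to_nat_on W w" by blast
      hence "a n = w" by (simp add: a_def countable)
      thus "n \<in> to_nat_on W ` (W \<inter> cball 0 r)" using w n by auto
    qed
    hence "finite {n. \<not> norm (a n) > r}"
      using W_fin[OF that] by (meson finite_imageI finite_subset)
    thus ?thesis by (simp add: eventually_cofinite flip: cofinite_eq_sequentially)
  qed

  define b where "b n = sgn (a n)" for n
  have b_norm: "norm (b n) = 1" for n
    by (simp add: b_def norm_sgn a_nz)
  have ab: "norm (a n - b n) = 1 - norm (a n)" for n
  proof -
    have "a n = of_real (norm (a n)) * b n"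
      by (simp add: b_def sgn_eq a_nz)
    hence "a n - b n = of_real (norm (a n) - 1) * b n"
      by (simp add: algebra_simps)
    hence "norm (a n - b n) = \<bar>norm (a n) - 1\<bar>"
      by (simp only: norm_mult b_norm norm_of_real mult_1_right)
    thus ?thesis using a_le[of n] by simp
  qed
  have zb: "norm (z - b n) \<ge> 1 - norm z" for z n
    using norm_triangle_ineq2[of "b n" z] by (simp add: b_norm norm_minus_commute)
  have zb_nz: "z - b n \<noteq> 0" if "z \<in> unit_disk" for z n
    using that b_norm[of n] by auto

  define w where "w n z = (a n - b n) / (z - b n)" for n z
  define E where "E n z = weierstrass_factor n (w n z)" for n z
  define P where "P N z = (\<Prod>n<N. E n z)" for N z
  define g where "g z = (\<Prod>n. E n z)" for z
  have w_holo: "w n holomorphic_on unit_disk" for n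
    unfolding w_def using zb_nz by (intro holomorphic_intros) auto
  have E_holo: "E n holomorphic_on unit_disk" for n
    unfolding E_def by (intro holomorphic_intros w_holo)
  have E_bound: "eventually (\<lambda>n. \<forall>z\<in>cball 0 R. norm (norm (E n z - 1)) \<le> 3 * (1 / 2) ^ Suc n) sequentially"
    if R: "R < 1" for R
  proof -
    \<comment> \<open>The denominator is at least \<open>1 - R\<close>, so half of that is what the numerator may be.\<close>
    have "eventually (\<lambda>n. norm (a n) > 1 - (1 - R) / 2) sequentially"
      using R by (intro a_ev) auto
    thus ?thesis
    proof eventually_elim
      case (elim n)
      show ?case
      proof
        fix z :: complex assume z: "z \<in> cball 0 R"
        have "norm (w n z) = (1 - norm (a n)) / norm (z - b n)"
          by (simp add: w_def norm_divide ab)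
        also have "\<dots> \<le> ((1 - R) / 2) / (1 - R)"
        proof (rule frac_le)
          show "1 - norm (a n) \<le> (1 - R) / 2" using elim by linarith
        qed (use z R zb[of z n] in auto)
        also have "\<dots> = 1 / 2" using R by (simp add: field_simps)
        finally have w: "norm (w n z) \<le> 1 / 2" .
        hence "norm (E n z - 1) \<le> 3 * norm (w n z) ^ Suc n"
          unfolding E_def by (rule weierstrass_factor_bound)
        also have "\<dots> \<le> 3 * (1 / 2) ^ Suc n"
          using w by (intro mult_left_mono power_mono) auto
        finally show "norm (norm (E n z - 1)) \<le> 3 * (1 / 2) ^ Suc n" by simp
      qed
    qed
  qed
  have summable: "summable (\<lambda>n. 3 * (1 / 2 :: real) ^ Suc n)"
    using summable_mult[OF summable_geometric[of "1/2::real"], of "3/2"] by simp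
  have prod: "(\<lambda>n. E n z) has_prod g z" if z: "z \<in> unit_disk" for z
  proof -
    have "eventually (\<lambda>n. norm (norm (E n z - 1)) \<le> 3 * (1 / 2) ^ Suc n) sequentially"
      using E_bound[of "norm z"] z by (auto elim: eventually_mono)
    hence "summable (\<lambda>n. norm (E n z - 1))"
      using summable by (rule summable_comparison_test_ev)
    hence "convergent_prod (\<lambda>n. E n z)"
      by (intro abs_convergent_prod_imp_convergent_prod) (simp add: abs_convergent_prod_conv_summable)
    thus ?thesis unfolding g_def by (rule convergent_prod_has_prod)
  qed
  have uniform: "uniform_limit (cball 0 R) P g sequentially" if R: "R < 1" for R
  proof -
    have sub: "cball 0 R \<subseteq> unit_disk" using R by auto
    have "uniformly_convergent_on (cball 0 R) P"
      unfolding P_def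
    proof (rule uniformly_convergent_on_prod')
      show "uniformly_convergent_on (cball 0 R) (\<lambda>N z. \<Sum>n<N. norm (E n z - 1))"
        by (rule Weierstrass_m_test'_ev[OF E_bound[OF R] summable])
      show "continuous_on (cball 0 R) (E n)" for n
        using E_holo sub holomorphic_on_imp_continuous_on holomorphic_on_subset by blast
    qed auto
    then obtain h where h: "uniform_limit (cball 0 R) P h sequentially"
      by (auto simp: uniformly_convergent_on_def)
    also have "?this \<longleftrightarrow> uniform_limit (cball 0 R) P g sequentially"
    proof (intro uniform_limit_cong)
      fix z :: complex assume z: "z \<in> cball 0 R"
      with h have "(\<lambda>n. P (Suc n) z) \<longlonglongrightarrow> h z"
        by (metis tendsto_uniform_limitI filterlim_sequentially_Suc)
      moreover have "(\<lambda>n. P (Suc n) z) \<longlonglongrightarrow> g z"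
        using has_prod_imp_tendsto[OF prod[of z]] z sub unfolding P_def lessThan_Suc_atMost by auto
      ultimately show "h z = g z"
        using tendsto_unique by force
    qed auto
    finally show ?thesis .
  qed
  show thesis
  proof
    show "g holomorphic_on unit_disk"
    proof (rule holomorphic_uniform_sequence)
      show "P N holomorphic_on unit_disk" for N
        unfolding P_def by (intro holomorphic_intros E_holo)
    next
      fix z :: complex assume z: "z \<in> unit_disk"
      define d where "d = (1 - norm z) / 2"
      have d: "d > 0" "norm z + d < 1" using z by (auto simp: d_def field_simps)
      have sub: "cball z d \<subseteq> cball 0 (norm z + d)"
        by (simp add: cball_subset_cball_iff)
      show "\<exists>d>0. cball z d \<subseteq> unit_disk \<and> uniform_limit (cball z d) P g sequentially"
      proof (intro exI[of _ d] conjI)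
        show "cball z d \<subseteq> unit_disk" using sub d(2) by force
        show "uniform_limit (cball z d) P g sequentially"
          by (rule uniform_limit_on_subset[OF uniform[OF d(2)] sub])
      qed (fact d)
    qed auto
  next
    fix z :: complex assume z: "z \<in> unit_disk"
    have "g z = 0 \<longleftrightarrow> 0 \<in> range (\<lambda>n. E n z)"
      by (rule has_prod_eq_0_iff[OF prod[OF z]])
    also have "\<dots> \<longleftrightarrow> (\<exists>n. E n z = 0)"
      by (simp add: image_iff)
    also have "\<dots> \<longleftrightarrow> (\<exists>n. z = a n)"
      unfolding E_def w_def weierstrass_factor_eq_0_iff using zb_nz[OF z] by (auto simp: divide_eq_1_iff)
    also have "\<dots> \<longleftrightarrow> z \<in> W" using range_a z by auto
    finally show "g z = 0 \<longleftrightarrow> z \<in> W" .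
  qed
qed

section \<open>Real Taylor coefficients and reflection\<close>

lemma reflected_sums:
  assumes "f has_fps_expansion F" "f holomorphic_on unit_disk" "z \<in> unit_disk"
  shows "(\<lambda>n. cnj (fps_nth F n) * z ^ n) sums cnj (f (cnj z))"
proof -
  have "(\<lambda>n. fps_nth F n * cnj z ^ n) sums f (cnj z)"
    by (rule has_fps_expansion_imp_sums_complex[OF assms(1), where r = 1])
       (use assms in \<open>auto simp flip: one_ereal_def\<close>)
  thus ?thesis by (subst sums_cnj[symmetric]) simp
qed

lemma reflection_symmetric_iff_real_coeffs:
  assumes F: "f has_fps_expansion F" and holo: "f holomorphic_on unit_disk"
  shows "(\<forall>z\<in>unit_disk. f (cnj z) = cnj (f z)) \<longleftrightarrow> (\<forall>n. fps_nth F n \<in> \<real>)"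
proof
  assume sym: "\<forall>z\<in>unit_disk. f (cnj z) = cnj (f z)"
  define G where "G = Abs_fps (\<lambda>n. cnj (fps_nth F n))"
  have "(\<lambda>n. fps_nth G n * z ^ n) sums f z" if "z \<in> unit_disk" for z
    using reflected_sums[OF F holo that] sym that by (simp add: G_def)
  hence "f has_fps_expansion G"
    by (intro has_fps_expansionI eventually_nhds_in_open[THEN eventually_mono, of unit_disk]) auto
  hence "F = G" using F fps_expansion_unique_complex by blast
  thus "\<forall>n. fps_nth F n \<in> \<real>"
    by (metis G_def Reals_cnj_iff fps_nth_Abs_fps)
next
  assume "\<forall>n. fps_nth F n \<in> \<real>"
  hence cnj: "cnj (fps_nth F n) = fps_nth F n" for n by (simp add: Reals_cnj_iff)
  show "\<forall>z\<in>unit_disk. f (cnj z) = cnj (f z)"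
  proof
    fix z :: complex assume z: "z \<in> unit_disk"
    have "(\<lambda>n. fps_nth F n * z ^ n) sums f z"
      by (rule has_fps_expansion_imp_sums_complex[OF F, where r = 1])
         (use holo z in \<open>auto simp flip: one_ereal_def\<close>)
    moreover have "(\<lambda>n. fps_nth F n * z ^ n) sums cnj (f (cnj z))"
      using reflected_sums[OF F holo z] by (simp add: cnj)
    ultimately show "f (cnj z) = cnj (f z)"
      by (metis complex_cnj_cnj sums_unique2)
  qed
qed

section \<open>Making real coefficients integral\<close>

text \<open>
  The differential equation of \<open>exp \<circ> g\<close> turns into a recursion for its coefficients, in which the
  coefficient of order \<open>n\<close> of \<open>g\<close> enters only at order \<open>n\<close>, and linearly.
\<close>

lemma fps_exp_compose_deriv:
  fixes g :: "complex fps"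
  assumes "fps_nth g 0 = 0"
  shows "fps_deriv (fps_exp 1 oo g) = (fps_exp 1 oo g) * fps_deriv g"
  using fps_compose_deriv[OF assms, of "fps_exp 1"] by simp

lemma fps_exp_compose_nth_Suc:
  fixes g :: "complex fps"
  assumes "fps_nth g 0 = 0"
  shows "of_nat (Suc n) * fps_nth (fps_exp 1 oo g) (Suc n) =
    (\<Sum>i=0..n. fps_nth (fps_exp 1 oo g) i * (of_nat (Suc (n - i)) * fps_nth g (Suc (n - i))))"
  using arg_cong[OF fps_exp_compose_deriv[OF assms], of "\<lambda>F. fps_nth F n"]
  by (simp add: fps_mult_nth)

text \<open>
  The triangularity behind the rounding procedure: at order \<open>n\<close> the new term of the exponent only
  adds to what the lower terms contribute, because the exponential has derivative \<open>1\<close> at \<open>0\<close>.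
\<close>

lemma mult_fps_exp_compose_nth:
  fixes F g h :: "complex fps"
  assumes "fps_nth g 0 = 0" "fps_nth h 0 = 0" and agree: "\<And>k. k < n \<Longrightarrow> fps_nth g k = fps_nth h k"
  shows "fps_nth (F * (fps_exp 1 oo g)) n =
    fps_nth (F * (fps_exp 1 oo h)) n + fps_nth F 0 * (fps_nth g n - fps_nth h n)"
proof -
  let ?E = "\<lambda>g. fps_exp 1 oo g"
  have low: "fps_nth (?E g) k = fps_nth (?E h) k" if "k < n" for k
    using that
  proof (induction k rule: less_induct)
    case (less k)
    show ?case
    proof (cases k)
      case (Suc m)
      have "of_nat (Suc m) * fps_nth (?E g) (Suc m) = of_nat (Suc m) * fps_nth (?E h) (Suc m)"
        unfolding fps_exp_compose_nth_Suc[OF assms(1)] fps_exp_compose_nth_Suc[OF assms(2)]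
        using less Suc by (intro sum.cong refl) (auto simp: agree)
      thus ?thesis using Suc by (simp del: of_nat_Suc)
    qed simp
  qed
  have top: "fps_nth (?E g) n = fps_nth (?E h) n + (fps_nth g n - fps_nth h n)"
  proof (cases n)
    case (Suc m)
    have "of_nat (Suc m) * (fps_nth (?E g) (Suc m) - fps_nth (?E h) (Suc m)) =
      (\<Sum>i=0..m. if i = 0 then of_nat (Suc m) * (fps_nth g (Suc m) - fps_nth h (Suc m)) else 0)"
      unfolding right_diff_distrib fps_exp_compose_nth_Suc[OF assms(1)]
        fps_exp_compose_nth_Suc[OF assms(2)] sum_subtractf[symmetric]
      using Suc by (intro sum.cong refl) (auto simp: agree low algebra_simps)
    hence "of_nat (Suc m) * (fps_nth (?E g) (Suc m) - fps_nth (?E h) (Suc m)) =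
      of_nat (Suc m) * (fps_nth g (Suc m) - fps_nth h (Suc m))"
      by simp
    hence "fps_nth (?E g) (Suc m) - fps_nth (?E h) (Suc m) = fps_nth g (Suc m) - fps_nth h (Suc m)"
      by (metis mult_cancel_left of_nat_eq_0_iff nat.distinct(2))
    thus ?thesis using Suc by (simp add: algebra_simps)
  qed (use assms in simp)
  have "fps_nth (F * ?E g) n - fps_nth (F * ?E h) n =
      (\<Sum>i=0..n. fps_nth F i * (fps_nth (?E g) (n - i) - fps_nth (?E h) (n - i)))"
    by (simp add: fps_mult_nth algebra_simps flip: sum_subtractf)
  also have "\<dots> = (\<Sum>i=0..n. if i = 0 then fps_nth F 0 * (fps_nth g n - fps_nth h n) else 0)"
    by (intro sum.cong refl) (auto simp: low top)
  finally show ?thesis by (simp add: algebra_simps)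
qed

lemma fps_mult_real_coeffs:
  fixes F G :: "complex fps"
  assumes "\<And>n. fps_nth F n \<in> \<real>" "\<And>n. fps_nth G n \<in> \<real>"
  shows "fps_nth (F * G) n \<in> \<real>"
  unfolding fps_mult_nth using assms by auto

lemma fps_exp_compose_real_coeffs:
  fixes g :: "complex fps"
  assumes g: "\<And>n. fps_nth g n \<in> \<real>"
  shows "fps_nth (fps_exp 1 oo g) n \<in> \<real>"
proof -
  have "fps_nth (g ^ i) k \<in> \<real>" for i k
  proof (induction i arbitrary: k)
    case (Suc i)
    thus ?case using fps_mult_real_coeffs[of g "g ^ i"] g by simp
  qed (auto simp: fps_one_nth)
  moreover have "(fact i :: complex) \<in> \<real>" for i
    by (metis of_nat_fact Reals_of_nat)
  ultimately show ?thesis unfolding fps_compose_nth by (auto intro!: sum_in_Reals Reals_divide)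
qed

text \<open>
  A real number lies within \<open>1/2\<close> of an integer, whereas a complex one may be far from all of
  them; hence the series to be rounded has to have real coefficients, and the exponent is kept
  real so that this remains true throughout. In the recursion, the exponent truncated below \<open>n\<close> shows what the \<open>n\<close>-th
  coefficient would be without a term of order \<open>n\<close>; that term is the rounding error.
\<close>

fun rounding_exponent :: "complex fps \<Rightarrow> nat \<Rightarrow> real" where
  "rounding_exponent F n = (if n = 0 then 0 else
     let r = Re (fps_nth (F * (fps_exp 1 oo
               Abs_fps (\<lambda>k. if k < n then of_real (rounding_exponent F k) else 0))) n)
     in of_int (round r) - r)"

declare rounding_exponent.simps [simp del]

text \<open>
  The bound \<open>1/2\<close> is what makes the exponent holomorphic on the disk: a rounding error is never
  larger, however fast the coefficients of \<open>F\<close> grow.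
\<close>

lemma exists_integralising_exponent:
  fixes F :: "complex fps"
  assumes F_0: "fps_nth F 0 = 1" and F_real: "\<And>n. fps_nth F n \<in> \<real>"
  obtains g where "fps_nth g 0 = 0" "\<And>n. norm (fps_nth g n) \<le> 1 / 2"
    "\<And>n. fps_nth (F * (fps_exp 1 oo g)) n \<in> \<int>"
proof
  define c where "c = rounding_exponent F"
  define g :: "complex fps" where "g = Abs_fps (\<lambda>n. of_real (c n))"
  have c_0: "c 0 = 0" by (simp add: c_def rounding_exponent.simps)
  thus g_0: "fps_nth g 0 = 0" by (simp add: g_def)
  define h where "h n = Abs_fps (\<lambda>k. if k < n then of_real (c k) else 0 :: complex)" for n
  have c: "c n = of_int (round (Re (fps_nth (F * (fps_exp 1 oo h n)) n)))
                 - Re (fps_nth (F * (fps_exp 1 oo h n)) n)" if "n > 0" for n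
    unfolding c_def h_def by (subst rounding_exponent.simps) (use that in \<open>simp add: Let_def\<close>)
  have "\<bar>c n\<bar> \<le> 1 / 2" for n
    by (cases "n = 0") (use c_0 of_int_round_abs_le in \<open>auto simp: c\<close>)
  thus "norm (fps_nth g n) \<le> 1 / 2" for n by (simp add: g_def)
  show "fps_nth (F * (fps_exp 1 oo g)) n \<in> \<int>" for n
  proof (cases "n = 0")
    case False
    define r where "r = fps_nth (F * (fps_exp 1 oo h n)) n"
    have "r \<in> \<real>" unfolding r_def
      by (intro fps_mult_real_coeffs fps_exp_compose_real_coeffs F_real) (auto simp: h_def)
    hence r: "of_real (Re r) = r" by simp
    have "fps_nth (F * (fps_exp 1 oo g)) n = r + fps_nth F 0 * (fps_nth g n - fps_nth (h n) n)"
      unfolding r_def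
      by (rule mult_fps_exp_compose_nth) (use g_0 False c_0 in \<open>auto simp: h_def g_def\<close>)
    also have "\<dots> = r + of_real (c n)" by (simp add: F_0 h_def g_def)
    also have "\<dots> = of_int (round (Re r))"
      using c[of n] False r by (simp flip: r_def) 
    finally show ?thesis by simp
  qed (simp add: F_0)
qed

section \<open>The ring of holomorphic functions with integer coefficients\<close>

lemma conj_invariant_iff: "conj_invariant W \<longleftrightarrow> (\<forall>z. z \<in> W \<longrightarrow> cnj z \<in> W)"
proof
  assume *: "\<forall>z. z \<in> W \<longrightarrow> cnj z \<in> W"
  hence "z \<in> cnj ` W" if "z \<in> W" for z
    using that by (intro image_eqI[of _ _ "cnj z"]) auto
  thus "conj_invariant W" using * by (auto simp: conj_invariant_def)
qed (auto simp: conj_invariant_def)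

lemma unit_disk_subset_eball:
  assumes "1 \<le> R"
  shows "unit_disk \<subseteq> eball 0 R"
proof
  fix z :: complex assume "z \<in> unit_disk"
  hence "ereal (norm z) < 1" by (simp add: one_ereal_def)
  also have "1 \<le> R" by fact
  finally show "z \<in> eball 0 R" by (simp add: in_eball_iff)
qed

lemma restrict_mem_integer_holomorphic_ring:
  assumes "f has_fps_expansion F" "f holomorphic_on unit_disk" "\<And>n. fps_nth F n \<in> \<int>"
  shows "restrict f unit_disk \<in> carrier integer_holomorphic_ring"
proof -
  have "fps_expansion (restrict f unit_disk) 0 = fps_expansion f 0"
    by (intro fps_expansion_cong eventually_nhds_in_open[THEN eventually_mono, of unit_disk]) auto
  also have "\<dots> = F" by (rule fps_expansion_eqI) fact
  moreover have "restrict f unit_disk holomorphic_on unit_disk"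
    using assms(2) by (rule holomorphic_transform) simp
  ultimately show ?thesis using assms by (simp add: integer_holomorphic_ring_def)
qed

lemma integer_holomorphic_ringD:
  assumes "h \<in> carrier integer_holomorphic_ring"
  shows "h \<in> extensional unit_disk" "h holomorphic_on unit_disk"
    "h has_fps_expansion fps_expansion h 0" "\<And>n. fps_nth (fps_expansion h 0) n \<in> \<int>"
  using assms has_fps_expansion_fps_expansion[of unit_disk h]
  by (auto simp: integer_holomorphic_ring_def)

text \<open>
  The three constructions combined: a Weierstrass product, symmetrised by its reflection and then
  rounded by an exponential factor.
\<close>

lemma exists_integer_function_with_zero_set:
  assumes W_disk: "W \<subseteq> unit_disk" and W_0: "0 \<notin> W"
    and W_fin: "\<And>r. r < 1 \<Longrightarrow> finite (W \<inter> cball 0 r)" and W_cnj: "conj_invariant W"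
  obtains f where "f \<in> carrier integer_holomorphic_ring" "f 0 = 1" "zero_set f = W"
proof -
  obtain u where u_holo: "u holomorphic_on unit_disk"
    and u_0: "\<And>z. z \<in> unit_disk \<Longrightarrow> u z = 0 \<longleftrightarrow> z \<in> W"
    using holomorphic_on_disk_with_zero_set[OF W_disk W_0 W_fin] by blast
  have W_iff: "cnj z \<in> W \<longleftrightarrow> z \<in> W" for z
    using W_cnj unfolding conj_invariant_iff by (metis complex_cnj_cnj)
  define k where "k = u 0 * cnj (u 0)"
  have k: "k \<noteq> 0" "cnj k = k" using u_0[of 0] W_0 by (auto simp: k_def)
  \<comment> \<open>Multiplying by the reflection makes the coefficients real without new zeros.\<close>
  define v where "v z = u z * cnj (u (cnj z)) / k" for z
  have "(cnj \<circ> u \<circ> cnj) holomorphic_on unit_disk"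
  proof (rule holomorphic_on_compose_cnj_cnj)
    show "u holomorphic_on cnj ` unit_disk"
      by (rule holomorphic_on_subset[OF u_holo]) auto
  qed auto
  hence v_holo: "v holomorphic_on unit_disk"
    unfolding v_def o_def using k by (intro holomorphic_intros u_holo) auto
  have v_zero: "v z = 0 \<longleftrightarrow> z \<in> W" if "z \<in> unit_disk" for z
    using u_0[of z] u_0[of "cnj z"] that k W_iff by (auto simp: v_def)
  define F where "F = fps_expansion v 0"
  have F: "v has_fps_expansion F"
    unfolding F_def using v_holo by (intro has_fps_expansion_fps_expansion[of unit_disk]) auto
  have "v 0 = 1" using k by (simp add: v_def k_def)
  hence F_0: "fps_nth F 0 = 1"
    using has_fps_expansion_imp_0_eq_fps_nth_0[OF F] by simp
  have "\<forall>z\<in>unit_disk. v (cnj z) = cnj (v z)"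
    using k by (simp add: v_def mult.commute)
  hence F_real: "fps_nth F n \<in> \<real>" for n
    using reflection_symmetric_iff_real_coeffs[OF F v_holo] by blast
  obtain g where g_0: "fps_nth g 0 = 0" and g_le: "\<And>n. norm (fps_nth g n) \<le> 1 / 2"
    and int: "\<And>n. fps_nth (F * (fps_exp 1 oo g)) n \<in> \<int>"
    using exists_integralising_exponent[OF F_0 F_real] by blast
  have g_radius: "fps_conv_radius g \<ge> 1"
    unfolding fps_conv_radius_def
  proof (rule conv_radius_geI_ex')
    fix r :: real assume r: "0 < r" "ereal r < 1"
    show "summable (\<lambda>n. fps_nth g n * of_real r ^ n)"
    proof (rule summable_comparison_test')
      show "summable (\<lambda>n. r ^ n)" using r by (simp add: summable_geometric)
      show "norm (fps_nth g n * of_real r ^ n) \<le> r ^ n" for n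
        using mult_right_mono[of "norm (fps_nth g n)" 1 "r ^ n"] order.trans[OF g_le, of 1 n] r
        by (simp add: norm_mult norm_power)
    qed
  qed
  hence sub: "unit_disk \<subseteq> eball 0 (fps_conv_radius g)"
    by (rule unit_disk_subset_eball)
  define f where "f z = v z * (exp \<circ> eval_fps g) z" for z
  have "eval_fps g holomorphic_on unit_disk"
    using sub by (rule holomorphic_on_eval_fps)
  hence f_holo: "f holomorphic_on unit_disk"
    unfolding f_def
    by (intro holomorphic_on_mult v_holo holomorphic_on_compose holomorphic_on_exp)
  have "fps_conv_radius g > 0" using g_radius by (rule less_le_trans[rotated]) simp
  hence f_exp: "f has_fps_expansion F * (fps_exp 1 oo g)"
    unfolding f_def using g_0
    by (intro has_fps_expansion_mult F has_fps_expansion_compose has_fps_expansion_exp1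
        eval_fps_has_fps_expansion) auto
  show thesis
  proof
    show "restrict f unit_disk \<in> carrier integer_holomorphic_ring"
      using f_exp f_holo int by (rule restrict_mem_integer_holomorphic_ring)
    show "restrict f unit_disk 0 = 1"
      using \<open>v 0 = 1\<close> g_0 by (simp add: f_def eval_fps_at_0)
    show "zero_set (restrict f unit_disk) = W"
      using v_zero W_disk by (auto simp: zero_set_def f_def)
  qed
qed

text \<open>
  Integers are real, so these functions commute with conjugation. Hence only
  conjugation-invariant sets can be realised as zero sets.
\<close>

lemma conj_invariant_zero_set:
  assumes "h \<in> carrier integer_holomorphic_ring"
  shows "conj_invariant (zero_set h)"
proof -
  note h = integer_holomorphic_ringD[OF assms]
  have "\<forall>n. fps_nth (fps_expansion h 0) n \<in> \<real>"
    using h(4) by (metis Ints_cases Reals_of_int)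
  hence "\<forall>z\<in>unit_disk. h (cnj z) = cnj (h z)"
    using reflection_symmetric_iff_real_coeffs[OF h(3,2)] by blast
  thus ?thesis by (simp add: conj_invariant_iff zero_set_def)
qed

lemma one_plus_z_times_mem:
  assumes "H \<in> carrier integer_holomorphic_ring"
  shows "one_plus_z_times H \<in> carrier integer_holomorphic_ring" 
proof -
  note H = integer_holomorphic_ringD[OF assms]
  show ?thesis unfolding one_plus_z_times_def
  proof (rule restrict_mem_integer_holomorphic_ring)
    show "(\<lambda>z. 1 + z * H z) has_fps_expansion 1 + fps_X * fps_expansion H 0"
      by (intro fps_expansion_intros H)
    show "(\<lambda>z. 1 + z * H z) holomorphic_on unit_disk"
      by (intro holomorphic_intros H)
    show "fps_nth (1 + fps_X * fps_expansion H 0) n \<in> \<int>" for n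
      using H(4) by (cases n) auto
  qed
qed

text \<open>
  Dividing \<open>f - 1\<close> by \<open>z\<close> shifts the Taylor series, which keeps its radius of convergence and the
  integrality of its coefficients.
\<close>

lemma constant_term_one_imp_one_plus_z_times:
  assumes f: "f \<in> carrier integer_holomorphic_ring" and f_0: "f 0 = 1"
  obtains H where "H \<in> carrier integer_holomorphic_ring" "f = one_plus_z_times H"
proof -
  note F = integer_holomorphic_ringD[OF f]
  let ?F = "fps_expansion f 0"
  define G where "G = fps_shift 1 ?F"
  have F_G: "?F = 1 + fps_X * G"
  proof (rule fps_ext)
    show "fps_nth ?F n = fps_nth (1 + fps_X * G) n" for n
      using f_0 has_fps_expansion_imp_0_eq_fps_nth_0[OF F(3)] by (cases n) (auto simp: G_def)
  qed
  have "fps_conv_radius ?F \<ge> ereal 1"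
    by (rule conv_radius_fps_expansion) (use F(2) in simp)
  hence radius: "fps_conv_radius G \<ge> 1" by (simp add: G_def one_ereal_def)
  hence sub: "unit_disk \<subseteq> eball 0 (fps_conv_radius G)"
    by (rule unit_disk_subset_eball)
  have "fps_conv_radius G > 0" using radius by (rule less_le_trans[rotated]) simp
  hence "restrict (eval_fps G) unit_disk \<in> carrier integer_holomorphic_ring"
    using F(4) sub by (intro restrict_mem_integer_holomorphic_ring[of _ G] eval_fps_has_fps_expansion
       holomorphic_on_eval_fps) (simp_all add: G_def)
  moreover have "f = one_plus_z_times (restrict (eval_fps G) unit_disk)"
  proof (rule extensionalityI[OF F(1)])
    fix z :: complex assume z: "z \<in> unit_disk"
    hence "ereal (norm z) < fps_conv_radius G" using sub by auto
    hence "eval_fps ?F z = 1 + z * eval_fps G z"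
      unfolding F_G using fps_conv_radius_mult[of fps_X G]
      by (subst eval_fps_add) (auto simp: eval_fps_mult)
    moreover have "eval_fps ?F z = f z"
      using has_fps_expansion_imp_eval_fps_eq[OF F(3), of z 1] z F(2) by simp
    ultimately show "f z = one_plus_z_times (restrict (eval_fps G) unit_disk) z"
      using z by (simp add: one_plus_z_times_def)
  qed (simp add: one_plus_z_times_def)
  ultimately show thesis by (rule that) 
qed

lemma cring_integer_holomorphic_ring: "cring integer_holomorphic_ring"
proof -
  let ?R = integer_holomorphic_ring
  have add: "g \<oplus>\<^bsub>?R\<^esub> h \<in> carrier ?R" if "g \<in> carrier ?R" "h \<in> carrier ?R" for g h
    using restrict_mem_integer_holomorphic_ring[OF has_fps_expansion_add[OF
        integer_holomorphic_ringD(3)[OF that(1)] integer_holomorphic_ringD(3)[OF that(2)]]]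
      that[THEN integer_holomorphic_ringD(2)] that[THEN integer_holomorphic_ringD(4)]
    by (simp add: integer_holomorphic_ring_def holomorphic_on_add)
  have int_mult: "fps_nth (F * G) n \<in> \<int>"
    if "\<And>n. fps_nth F n \<in> \<int>" "\<And>n. fps_nth G n \<in> \<int>" for F G :: "complex fps" and n
    unfolding fps_mult_nth using that by (intro Ints_sum Ints_mult)
  have mult: "g \<otimes>\<^bsub>?R\<^esub> h \<in> carrier ?R" if "g \<in> carrier ?R" "h \<in> carrier ?R" for g h
    using restrict_mem_integer_holomorphic_ring[OF has_fps_expansion_mult[OF
        integer_holomorphic_ringD(3)[OF that(1)] integer_holomorphic_ringD(3)[OF that(2)]]]
      that[THEN integer_holomorphic_ringD(2)] that[THEN integer_holomorphic_ringD(4)]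
    by (simp add: integer_holomorphic_ring_def holomorphic_on_mult int_mult)
  have zero: "\<zero>\<^bsub>?R\<^esub> \<in> carrier ?R"
    using restrict_mem_integer_holomorphic_ring[OF has_fps_expansion_0]
    by (simp add: integer_holomorphic_ring_def)
  have one: "\<one>\<^bsub>?R\<^esub> \<in> carrier ?R"
    using restrict_mem_integer_holomorphic_ring[OF has_fps_expansion_1]
    by (simp add: integer_holomorphic_ring_def fps_one_nth)
  have minus: "(\<lambda>z\<in>unit_disk. - h z) \<in> carrier ?R" if "h \<in> carrier ?R" for h
    using restrict_mem_integer_holomorphic_ring[OF has_fps_expansion_minus[OF
        integer_holomorphic_ringD(3)[OF that]]]
      integer_holomorphic_ringD[OF that]
    by (simp add: holomorphic_on_minus)
  have ops: "g \<oplus>\<^bsub>?R\<^esub> h = (\<lambda>z\<in>unit_disk. g z + h z)" "g \<otimes>\<^bsub>?R\<^esub> h = (\<lambda>z\<in>unit_disk. g z * h z)"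
    "\<zero>\<^bsub>?R\<^esub> = (\<lambda>z\<in>unit_disk. 0)" "\<one>\<^bsub>?R\<^esub> = (\<lambda>z\<in>unit_disk. 1)" for g h
    by (simp_all add: integer_holomorphic_ring_def)
  show ?thesis
  proof (rule cringI)
    show "abelian_group ?R"
    proof (rule abelian_groupI)
      show "\<exists>g\<in>carrier ?R. g \<oplus>\<^bsub>?R\<^esub> h = \<zero>\<^bsub>?R\<^esub>" if "h \<in> carrier ?R" for h
        by (rule bexI[OF _ minus[OF that]]) (auto simp: ops restrict_def)
      show "\<zero>\<^bsub>?R\<^esub> \<oplus>\<^bsub>?R\<^esub> h = h" if "h \<in> carrier ?R" for h
        by (rule ext) (use integer_holomorphic_ringD(1)[OF that] in \<open>auto simp: ops extensional_def\<close>)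
    qed (auto simp: add zero, auto simp: ops restrict_def add_ac)
    show "comm_monoid ?R"
    proof (rule comm_monoidI)
      show "\<one>\<^bsub>?R\<^esub> \<otimes>\<^bsub>?R\<^esub> h = h" if "h \<in> carrier ?R" for h
        by (rule ext) (use integer_holomorphic_ringD(1)[OF that] in \<open>auto simp: ops extensional_def\<close>)
    qed (auto simp: mult one, auto simp: ops restrict_def mult_ac)
  qed (auto simp: ops restrict_def algebra_simps)
qed

section \<open>The ultraproduct and the evaluation map\<close>

lemma complex_power_ring_simps:
  "carrier (complex_power_ring A) = A \<rightarrow>\<^sub>E UNIV"
  "x \<otimes>\<^bsub>complex_power_ring A\<^esub> y = (\<lambda>a\<in>A. x a * y a)"
  "x \<oplus>\<^bsub>complex_power_ring A\<^esub> y = (\<lambda>a\<in>A. x a + y a)"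
  "\<one>\<^bsub>complex_power_ring A\<^esub> = (\<lambda>a\<in>A. 1)"
  "\<zero>\<^bsub>complex_power_ring A\<^esub> = (\<lambda>a\<in>A. 0)"
  by (simp_all add: complex_power_ring_def)

lemma cring_complex_power_ring: "cring (complex_power_ring A)"
proof -
  let ?R = "complex_power_ring A"
  show ?thesis
  proof (rule cringI)
    show "abelian_group ?R"
    proof (rule abelian_groupI)
      show "\<exists>y\<in>carrier ?R. y \<oplus>\<^bsub>?R\<^esub> x = \<zero>\<^bsub>?R\<^esub>" for x
        by (rule bexI[of _ "\<lambda>a\<in>A. - x a"]) (auto simp: complex_power_ring_simps restrict_def)
      show "\<zero>\<^bsub>?R\<^esub> \<oplus>\<^bsub>?R\<^esub> x = x" if "x \<in> carrier ?R" for x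
        by (rule ext) (use that in \<open>auto simp: complex_power_ring_simps PiE_def extensional_def\<close>)
    qed (auto simp: complex_power_ring_simps restrict_def add_ac)
    show "comm_monoid ?R"
    proof (rule comm_monoidI)
      show "\<one>\<^bsub>?R\<^esub> \<otimes>\<^bsub>?R\<^esub> x = x" if "x \<in> carrier ?R" for x
        by (rule ext) (use that in \<open>auto simp: complex_power_ring_simps PiE_def extensional_def\<close>)
    qed (auto simp: complex_power_ring_simps restrict_def mult_ac)
  qed (auto simp: complex_power_ring_simps restrict_def algebra_simps)
qed

lemma ultrafilter_onD:
  assumes "ultrafilter_on A U"
  shows "\<And>W. W \<in> U \<Longrightarrow> W \<subseteq> A" "A \<in> U" "{} \<notin> U"
    "\<And>V W. V \<in> U \<Longrightarrow> W \<in> U \<Longrightarrow> V \<inter> W \<in> U"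
    "\<And>V W. V \<in> U \<Longrightarrow> V \<subseteq> W \<Longrightarrow> W \<subseteq> A \<Longrightarrow> W \<in> U"
    "\<And>W. W \<subseteq> A \<Longrightarrow> W \<notin> U \<Longrightarrow> A - W \<in> U"
proof -
  have sub: "U \<subseteq> Pow A"
    using assms unfolding ultrafilter_on_def by (elim conjE)
  have top: "A \<in> U"
    using assms unfolding ultrafilter_on_def by (elim conjE)
  have bot: "{} \<notin> U"
    using assms unfolding ultrafilter_on_def by (elim conjE)
  have int: "\<forall>V\<in>U. \<forall>W\<in>U. V \<inter> W \<in> U"
    using assms unfolding ultrafilter_on_def by (elim conjE)
  have up: "\<forall>V\<in>U. \<forall>W. V \<subseteq> W \<and> W \<subseteq> A \<longrightarrow> W \<in> U"
    using assms unfolding ultrafilter_on_def by (elim conjE)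
  have ultra: "\<forall>W. W \<subseteq> A \<longrightarrow> W \<in> U \<or> A - W \<in> U"
    using assms unfolding ultrafilter_on_def by (elim conjE)
  show "\<And>W. W \<in> U \<Longrightarrow> W \<subseteq> A" using sub by blast
  show "A \<in> U" by (fact top)
  show "{} \<notin> U" by (fact bot)
  show "\<And>V W. V \<in> U \<Longrightarrow> W \<in> U \<Longrightarrow> V \<inter> W \<in> U" using int by blast
  show "\<And>V W. V \<in> U \<Longrightarrow> V \<subseteq> W \<Longrightarrow> W \<subseteq> A \<Longrightarrow> W \<in> U" using up by blast
  show "\<And>W. W \<subseteq> A \<Longrightarrow> W \<notin> U \<Longrightarrow> A - W \<in> U" using ultra by blast
qed

text \<open>
  Closure of the ultrafilter under intersections and supersets makes the null families an ideal,
  and the dichotomy between a set and its complement makes that ideal maximal.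
\<close>

lemma maximalideal_null_families:
  assumes U: "ultrafilter_on A U"
  shows "maximalideal (null_families A U) (complex_power_ring A)"
proof -
  let ?R = "complex_power_ring A" and ?N = "null_families A U"
  note U = ultrafilter_onD[OF U]
  interpret R: cring ?R by (rule cring_complex_power_ring)
  have N: "?N = {x \<in> A \<rightarrow>\<^sub>E UNIV. {a \<in> A. x a = 0} \<in> U}"
    by (simp add: null_families_def)
  have N_mono: "y \<in> ?N" if "x \<in> ?N" "y \<in> A \<rightarrow>\<^sub>E UNIV" "\<And>a. a \<in> A \<Longrightarrow> x a = 0 \<Longrightarrow> y a = 0" for x y
    using that U(5)[of "{a \<in> A. x a = 0}" "{a \<in> A. y a = 0}"] by (auto simp: N)
  have N_add: "x \<oplus>\<^bsub>?R\<^esub> y \<in> ?N" if "x \<in> ?N" "y \<in> ?N" for x y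
  proof -
    have "{a \<in> A. x a = 0} \<inter> {a \<in> A. y a = 0} \<in> U"
      using that by (intro U(4)) (auto simp: N)
    hence "{a \<in> A. x a + y a = 0} \<in> U"
      by (rule U(5)) auto
    thus ?thesis by (auto simp: N complex_power_ring_simps cong: conj_cong)
  qed
  have N_mult: "x \<otimes>\<^bsub>?R\<^esub> y \<in> ?N" if "x \<in> ?N" "y \<in> carrier ?R" for x y
    by (rule N_mono[OF that(1)]) (auto simp: complex_power_ring_simps)
  have N_sub: "?N \<subseteq> carrier ?R" by (auto simp: N complex_power_ring_simps)
  have minus: "\<ominus>\<^bsub>?R\<^esub> x = (\<lambda>a\<in>A. - x a)" if "x \<in> carrier ?R" for x
    by (rule R.minus_equality) (use that in \<open>auto simp: complex_power_ring_simps restrict_def\<close>)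
  have ideal: "ideal ?N ?R"
  proof (rule idealI[OF R.ring_axioms])
    show "subgroup ?N (add_monoid ?R)"
    proof (rule R.add.subgroupI)
      show "?N \<noteq> {}"
        using U(2) by (auto simp: N intro!: exI[of _ "\<lambda>a\<in>A. 0"] cong: conj_cong)
      show "\<ominus>\<^bsub>?R\<^esub> x \<in> ?N" if "x \<in> ?N" for x
        using minus[of x] N_sub that by (intro N_mono[OF that]) auto
    qed (use N_sub N_add in auto)
  next
    fix x y assume xy: "x \<in> ?N" "y \<in> carrier ?R"
    thus "x \<otimes>\<^bsub>?R\<^esub> y \<in> ?N" by (rule N_mult)
    thus "y \<otimes>\<^bsub>?R\<^esub> x \<in> ?N" using R.m_comm xy N_sub by auto
  qed
  have one: "\<one>\<^bsub>?R\<^esub> \<notin> ?N"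
    using U(3) by (simp add: N complex_power_ring_simps cong: conj_cong)
  show ?thesis
  proof (rule maximalidealI[OF ideal])
    show "carrier ?R \<noteq> ?N" using one by auto
  next
    fix J assume J: "ideal J ?R" "?N \<subseteq> J" "J \<subseteq> carrier ?R"
    interpret J: ideal J ?R by fact
    show "J = ?N \<or> J = carrier ?R"
    proof (cases "J \<subseteq> ?N")
      case False
      then obtain x where x: "x \<in> J" "x \<notin> ?N" by blast
      \<comment> \<open>The zeros of \<open>x\<close> are not large, so the idempotent supported there is null, while
        \<open>x\<close> is invertible off its zeros: together they give a unit of \<open>J\<close>.\<close>
      define e where "e = (\<lambda>a\<in>A. if x a = 0 then 1 else 0 :: complex)"
      define y where "y = (\<lambda>a\<in>A. inverse (x a))"
      have "A - {a \<in> A. x a = 0} \<in> U"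
        using x J(3) by (intro U(6)) (auto simp: N complex_power_ring_simps)
      moreover have "{a \<in> A. e a = 0} = A - {a \<in> A. x a = 0}"
        by (auto simp: e_def)
      ultimately have "e \<in> ?N" by (simp add: N) (simp add: e_def)
      hence "e \<in> J" using J(2) by blast
      moreover have "x \<otimes>\<^bsub>?R\<^esub> y \<in> J"
        using x(1) by (rule J.I_r_closed) (simp add: y_def complex_power_ring_simps)
      ultimately have "e \<oplus>\<^bsub>?R\<^esub> (x \<otimes>\<^bsub>?R\<^esub> y) \<in> J" by (rule J.a_closed)
      also have "e \<oplus>\<^bsub>?R\<^esub> (x \<otimes>\<^bsub>?R\<^esub> y) = \<one>\<^bsub>?R\<^esub>"
        by (auto simp: complex_power_ring_simps e_def y_def restrict_def)
      finally have "J = carrier ?R" by (rule J.one_imp_carrier)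
      thus ?thesis ..
    qed (use J in auto)
  qed
qed

lemma field_ultraproduct:
  assumes "ultrafilter_on A U"
  shows "field (ultraproduct A U)"
  unfolding ultraproduct_def
  by (rule maximalideal.quotient_is_field[OF maximalideal_null_families[OF assms] cring_complex_power_ring])

lemma ring_hom_evaluation_hom:
  assumes A: "A \<subseteq> unit_disk" and U: "ultrafilter_on A U"
  shows "ring_hom_ring integer_holomorphic_ring (ultraproduct A U) (evaluation_hom A U)"
proof -
  interpret maximalideal "null_families A U" "complex_power_ring A"
    by (rule maximalideal_null_families[OF U])
  have "(\<lambda>h. restrict h A) \<in> ring_hom integer_holomorphic_ring (complex_power_ring A)"
    using A by (intro ring_hom_memI)
      (auto simp: integer_holomorphic_ring_def complex_power_ring_simps restrict_def subset_iff)
  hence "(+>\<^bsub>complex_power_ring A\<^esub>) (null_families A U) \<circ> (\<lambda>h. restrict h A)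
           \<in> ring_hom integer_holomorphic_ring (ultraproduct A U)"
    using rcos_ring_hom unfolding ultraproduct_def by (rule ring_hom_trans)
  moreover have "(+>\<^bsub>complex_power_ring A\<^esub>) (null_families A U) \<circ> (\<lambda>h. restrict h A) = evaluation_hom A U"
    by (simp add: fun_eq_iff evaluation_hom_def)
  ultimately show ?thesis
    using cring_integer_holomorphic_ring quotient_is_ring
    by (intro ring_hom_ringI2) (auto simp: cring_def ultraproduct_def)
qed

lemma mem_ultrafilter_ideal_iff:
  assumes U: "ultrafilter_on A U"
  shows "h \<in> ultrafilter_ideal A U \<longleftrightarrow>
    h \<in> carrier integer_holomorphic_ring \<and> {a \<in> A. h a = 0} \<in> U"
proof -
  let ?R = "complex_power_ring A" and ?N = "null_families A U"
  interpret maximalideal ?N ?R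
    by (rule maximalideal_null_families[OF U])
  have mem: "restrict h A \<in> carrier ?R" by (simp add: complex_power_ring_simps)
  have "?N +>\<^bsub>?R\<^esub> restrict h A = ?N \<longleftrightarrow> restrict h A \<in> ?N"
    using rcos_const_imp_mem[OF mem] a_rcos_const by blast
  also have "\<dots> \<longleftrightarrow> {a \<in> A. h a = 0} \<in> U"
    by (simp add: null_families_def cong: conj_cong)
  finally show ?thesis
    by (simp add: ultrafilter_ideal_def a_kernel_def' ultraproduct_def evaluation_hom_def FactRing_def)
qed

text \<open>
  The kernel is the preimage of the zero ideal of a field.
\<close>

lemma primeideal_ultrafilter_ideal:
  assumes A: "A \<subseteq> unit_disk" and U: "ultrafilter_on A U"
  shows "primeideal (ultrafilter_ideal A U) integer_holomorphic_ring"
proof -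
  interpret ring_hom_ring integer_holomorphic_ring "ultraproduct A U" "evaluation_hom A U"
    by (rule ring_hom_evaluation_hom[OF A U])
  have "primeideal {\<zero>\<^bsub>ultraproduct A U\<^esub>} (ultraproduct A U)"
    using field_ultraproduct[OF U] by (intro domain.zeroprimeideal) (simp add: field_def)
  from primeideal_vimage[OF cring_integer_holomorphic_ring this] show ?thesis
    unfolding ultrafilter_ideal_def a_kernel_def' singleton_iff .
qed

section \<open>Ultrafilters and complex conjugation\<close>

lemma ultrafilter_on_eqI:
  assumes "ultrafilter_on A U" "ultrafilter_on A V" "U \<subseteq> V"
  shows "U = V"
proof (intro equalityI subsetI)
  note U = ultrafilter_onD[OF assms(1)] and V = ultrafilter_onD[OF assms(2)]
  fix W assume W: "W \<in> V"
  show "W \<in> U"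
  proof (rule ccontr)
    assume "W \<notin> U"
    hence "W \<inter> (A - W) \<in> V" using U(6) V(1,4) W assms(3) by blast
    thus False using V(3) by simp
  qed
qed (use assms(3) in blast)

lemma ultrafilter_on_cnj_image:
  assumes A: "conj_invariant A" and U: "ultrafilter_on A U"
  shows "ultrafilter_on A ((`) cnj ` U)"
proof -
  note U = ultrafilter_onD[OF U]
  have cnj_cnj [simp]: "cnj ` cnj ` W = W" for W by (simp add: image_image)
  have inj: "inj cnj" by (simp add: inj_def)
  have mem: "W \<in> (`) cnj ` U \<longleftrightarrow> cnj ` W \<in> U" for W
    by (metis cnj_cnj image_iff)
  have A': "cnj ` A = A" using A by (simp add: conj_invariant_def)
  have sub: "cnj ` W \<subseteq> A" if "W \<subseteq> A" for W
    using image_mono[OF that, of cnj] A' by simp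
  show ?thesis unfolding ultrafilter_on_def
  proof (intro conjI ballI allI impI)
    show "(`) cnj ` U \<subseteq> Pow A" using U(1) sub by blast
    show "A \<in> (`) cnj ` U" "{} \<notin> (`) cnj ` U" using U(2,3) by (simp_all add: mem A')
    show "V \<inter> W \<in> (`) cnj ` U" if "V \<in> (`) cnj ` U" "W \<in> (`) cnj ` U" for V W
      using that U(4) by (simp add: mem image_Int[OF inj])
    show "W \<in> (`) cnj ` U" if "V \<in> (`) cnj ` U" "V \<subseteq> W \<and> W \<subseteq> A" for V W
      using that U(5)[of "cnj ` V" "cnj ` W"] sub image_mono[of V W cnj] by (simp add: mem)
    show "W \<in> (`) cnj ` U \<or> A - W \<in> (`) cnj ` U" if "W \<subseteq> A" for W
      using that U(6)[of "cnj ` W"] sub by (auto simp: mem image_set_diff[OF inj] A')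
  qed
qed

text \<open>
  A member \<open>W\<close> inside the closed upper half-plane is recovered from the invariant set
  \<open>W \<union> cnj ` W\<close> by intersecting with that half-plane again: a reflected point that lies in it is
  real, hence its own reflection.
\<close>

lemma ultrafilter_eq_of_conj_invariant_members:
  assumes A: "conj_invariant A" and U: "ultrafilter_on A U" and V: "ultrafilter_on A V"
    and eq: "\<And>W. conj_invariant W \<Longrightarrow> W \<in> U \<longleftrightarrow> W \<in> V"
    and U_half: "A \<inter> {z. Im z \<ge> 0} \<in> U" and V_half: "A \<inter> {z. Im z \<ge> 0} \<in> V"
  shows "U = V"
proof (rule ultrafilter_on_eqI[OF U V], rule subsetI)
  note U = ultrafilter_onD[OF U] and V = ultrafilter_onD[OF V]
  fix W assume W: "W \<in> U"
  let ?H = "W \<inter> (A \<inter> {z. Im z \<ge> 0})"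
  have H: "?H \<in> U" using W U_half by (rule U(4))
  have "conj_invariant (?H \<union> cnj ` ?H)"
    by (simp add: conj_invariant_def image_Un image_image Un_commute)
  moreover have "?H \<union> cnj ` ?H \<subseteq> A"
    using A unfolding conj_invariant_def by blast
  hence "?H \<union> cnj ` ?H \<in> U" using H by (intro U(5)[OF H]) auto
  ultimately have "?H \<union> cnj ` ?H \<in> V" using eq by blast
  hence "(?H \<union> cnj ` ?H) \<inter> (A \<inter> {z. Im z \<ge> 0}) \<in> V" using V_half by (rule V(4))
  moreover have "(?H \<union> cnj ` ?H) \<inter> (A \<inter> {z. Im z \<ge> 0}) \<subseteq> W"
  proof
    fix z assume z: "z \<in> (?H \<union> cnj ` ?H) \<inter> (A \<inter> {z. Im z \<ge> 0})"
    show "z \<in> W"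
    proof (cases "z \<in> ?H")
      case False
      then obtain w where w: "w \<in> ?H" "z = cnj w" using z by blast
      hence "Im w = 0" using z by auto
      hence "z = w" using w by (simp add: complex_eq_iff)
      thus ?thesis using w by blast
    qed blast
  qed
  ultimately show "W \<in> V" using U(1)[OF W] by (rule V(5))
qed

text \<open>
  Either the closed upper half of \<open>A\<close> or its reflection is a member of a given ultrafilter, and
  conjugating an ultrafilter changes none of its conjugation-invariant members. So both
  ultrafilters may be conjugated to contain the upper half, where the invariant members
  determine them.
\<close>

lemma ultrafilter_eq_or_conj_of_conj_invariant_members:
  assumes A: "conj_invariant A" and U: "ultrafilter_on A U" and V: "ultrafilter_on A V"
    and eq: "\<And>W. conj_invariant W \<Longrightarrow> W \<in> U \<longleftrightarrow> W \<in> V"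
  shows "U = V \<or> U = (`) cnj ` V"
proof -
  let ?H = "A \<inter> {z. Im z \<ge> 0}"
  have cnj_cnj: "cnj ` cnj ` W = W" for W by (simp add: image_image)
  have mem: "W \<in> (`) cnj ` X \<longleftrightarrow> cnj ` W \<in> X" for W X
    by (metis cnj_cnj image_iff)
  have half: "?H \<in> X \<or> ?H \<in> (`) cnj ` X" if X: "ultrafilter_on A X" for X
  proof (cases "?H \<in> X")
    case False
    hence "A - ?H \<in> X" using ultrafilter_onD(6)[OF X] by blast
    moreover have "A - ?H \<subseteq> cnj ` ?H"
    proof
      fix z assume "z \<in> A - ?H"
      hence "cnj z \<in> ?H" using A by (auto simp: conj_invariant_iff)
      thus "z \<in> cnj ` ?H" by (rule image_eqI[rotated]) simp
    qed
    moreover have "cnj ` ?H \<subseteq> A" using A by (auto simp: conj_invariant_iff)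
    ultimately show ?thesis
      using ultrafilter_onD(5)[OF X] mem by blast
  qed simp
  have eq_cnj: "W \<in> (`) cnj ` X \<longleftrightarrow> W \<in> X" if "conj_invariant W" for W X
    using that by (simp add: mem conj_invariant_def)
  note cnj = ultrafilter_on_cnj_image[OF A]
  have inj: "X = Y" if "(`) cnj ` X = (`) cnj ` Y" for X Y
    using that mem cnj_cnj by (metis subsetI subset_antisym)
  consider "?H \<in> U" "?H \<in> V" | "?H \<in> U" "?H \<in> (`) cnj ` V"
    | "?H \<in> (`) cnj ` U" "?H \<in> V" | "?H \<in> (`) cnj ` U" "?H \<in> (`) cnj ` V"
    using half[OF U] half[OF V] by blast
  thus ?thesis
  proof cases
    case 1
    hence "U = V"
      using eq by (intro ultrafilter_eq_of_conj_invariant_members[OF A U V]) auto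
    thus ?thesis ..
  next
    case 2
    hence "U = (`) cnj ` V"
      using eq eq_cnj by (intro ultrafilter_eq_of_conj_invariant_members[OF A U cnj[OF V]]) auto
    thus ?thesis ..
  next
    case 3
    hence "(`) cnj ` U = V"
      using eq eq_cnj by (intro ultrafilter_eq_of_conj_invariant_members[OF A cnj[OF U] V]) auto
    thus ?thesis by (auto simp: image_image)
  next
    case 4
    hence "(`) cnj ` U = (`) cnj ` V"
      using eq eq_cnj
      by (intro ultrafilter_eq_of_conj_invariant_members[OF A cnj[OF U] cnj[OF V]]) auto
    thus ?thesis using inj by blast
  qed
qed

section \<open>Prime ideals attached to ultrafilters\<close>

lemma admissible_divisorD:
  assumes "admissible_divisor Z"
  shows "divisor_support Z \<subseteq> unit_disk" "0 \<notin> divisor_support Z"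
    "conj_invariant (divisor_support Z)"
    "r < 1 \<Longrightarrow> finite (divisor_support Z \<inter> cball 0 r)"
proof -
  let ?A = "divisor_support Z"
  show "?A \<subseteq> unit_disk" "0 \<notin> ?A" using assms by (simp_all add: admissible_divisor_def)
  show "conj_invariant ?A"
    using assms by (simp add: conj_invariant_iff admissible_divisor_def divisor_support_def)
  assume r: "r < 1"
  show "finite (?A \<inter> cball 0 r)"
  proof (rule ccontr)
    \<comment> \<open>By compactness the points would accumulate inside the disk.\<close>
    assume "infinite (?A \<inter> cball 0 r)"
    then obtain a where a: "a \<in> cball 0 r" "a islimpt (?A \<inter> cball 0 r)"
      using compact_eq_Bolzano_Weierstrass[of "cball (0::complex) r"] by auto
    hence "a \<in> unit_disk" using r by auto
    then obtain e where "e > 0" "finite (ball a e \<inter> ?A)"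
      using assms unfolding admissible_divisor_def by blast
    moreover from this have "infinite (?A \<inter> cball 0 r \<inter> ball a e)"
      using a(2) by (simp add: islimpt_eq_infinite_ball)
    moreover have "?A \<inter> cball 0 r \<inter> ball a e \<subseteq> ball a e \<inter> ?A" by blast
    ultimately show False using finite_subset by blast
  qed
qed

theorem proposition6p1:
  fixes Z :: "complex \<Rightarrow> nat" and U :: "complex set set"
  defines "A \<equiv> divisor_support Z"
  assumes "admissible_divisor Z"
    and "ultrafilter_on A U"
  shows
    "(\<forall>W\<in>U. conj_invariant W \<longrightarrow>
       (\<exists>f\<in>carrier integer_holomorphic_ring. f 0 = 1 \<and> zero_set f = W)) \<and>
     (field (ultraproduct A U) \<and>
      ring_hom_ring integer_holomorphic_ring (ultraproduct A U) (evaluation_hom A U)) \<and>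
     (ultrafilter_ideal A U \<in> primes_one \<and>
      (\<forall>f\<in>carrier integer_holomorphic_ring.
         f 0 = 1 \<and> zero_set f = A \<longrightarrow> f \<in> ultrafilter_ideal A U)) \<and>
     (zero_filter Z (ultrafilter_ideal A U) = {W \<in> U. conj_invariant W} \<and>
      (\<forall>H\<in>carrier integer_holomorphic_ring.
         zero_set (one_plus_z_times H) \<subseteq> A \<longrightarrow>
           {a \<in> A. one_plus_z_times H a = 0} = zero_set (one_plus_z_times H) \<and>
           (one_plus_z_times H \<in> ultrafilter_ideal A U \<longleftrightarrow>
              zero_set (one_plus_z_times H) \<in> U))) \<and>
     (\<forall>U1 U2. ultrafilter_on A U1 \<and> ultrafilter_on A U2 \<and>
        ultrafilter_ideal A U1 = ultrafilter_ideal A U2 \<longrightarrow>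
          {W \<in> U1. conj_invariant W} = {W \<in> U2. conj_invariant W} \<and>
          (U1 = U2 \<or> U1 = (\<lambda>W. cnj ` W) ` U2))"
proof -
  note A = admissible_divisorD[OF assms(2), folded A_def]
  note U = assms(3)
  let ?R = integer_holomorphic_ring
  \<comment> \<open>Subsets of a locally finite set are locally finite, so the realisation applies to them.\<close>
  have realise: "\<exists>f\<in>carrier ?R. f 0 = 1 \<and> zero_set f = W" if "W \<subseteq> A" "conj_invariant W" for W
  proof (rule exists_integer_function_with_zero_set[of W])
    show "W \<subseteq> unit_disk" "0 \<notin> W" "conj_invariant W" using A(1,2) that by auto
    show "finite (W \<inter> cball 0 r)" if "r < 1" for r
      using A(4)[OF that] by (rule rev_finite_subset) (use \<open>W \<subseteq> A\<close> in blast)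
  qed blast
  have zeros: "{a \<in> A. h a = 0} = zero_set h" if "zero_set h \<subseteq> A" for h
    using that A(1) by (auto simp: zero_set_def)
  have mem: "h \<in> ultrafilter_ideal A V \<longleftrightarrow> h \<in> carrier ?R \<and> zero_set h \<in> V"
    if "ultrafilter_on A V" "zero_set h \<subseteq> A" for V h
    using mem_ultrafilter_ideal_iff[OF that(1)] zeros[OF that(2)] by simp

  have filter: "zero_filter Z (ultrafilter_ideal A V) = {W \<in> V. conj_invariant W}"
    if V: "ultrafilter_on A V" for V
  proof (intro equalityI subsetI)
    fix W assume "W \<in> zero_filter Z (ultrafilter_ideal A V)"
    then obtain h where h: "W = zero_set h" "h \<in> ultrafilter_ideal A V" "zero_set h \<subseteq> A"
      by (auto simp: zero_filter_def A_def)
    thus "W \<in> {W \<in> V. conj_invariant W}"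
      using mem[OF V h(3)] conj_invariant_zero_set by blast
  next
    fix W assume W: "W \<in> {W \<in> V. conj_invariant W}"
    hence "W \<subseteq> A" using ultrafilter_onD(1)[OF V] by blast
    then obtain f where f: "f \<in> carrier ?R" "f 0 = 1" "zero_set f = W"
      using realise W by blast
    hence "f \<in> ultrafilter_ideal A V" using mem[OF V, of f] W \<open>W \<subseteq> A\<close> by blast
    moreover obtain H where "H \<in> carrier ?R" "f = one_plus_z_times H"
      using constant_term_one_imp_one_plus_z_times[OF f(1,2)] by blast
    ultimately show "W \<in> zero_filter Z (ultrafilter_ideal A V)"
      using f(3) \<open>W \<subseteq> A\<close> unfolding zero_filter_def A_def by blast
  qed

  have contains: "f \<in> ultrafilter_ideal A U" if "f \<in> carrier ?R" "zero_set f = A" for f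
    using that mem[OF U, of f] ultrafilter_onD(2)[OF U] by blast
  have "ultrafilter_ideal A U \<in> primes_one"
  proof -
    obtain f where f: "f \<in> carrier ?R" "f 0 = 1" "zero_set f = A"
      using realise[OF order.refl A(3)] by blast
    then obtain H where "H \<in> carrier ?R" "f = one_plus_z_times H"
      using constant_term_one_imp_one_plus_z_times by blast
    thus ?thesis
      using contains[OF f(1,3)] primeideal_ultrafilter_ideal[OF A(1) U] by (auto simp: primes_one_def)
  qed
  moreover have "{W \<in> U1. conj_invariant W} = {W \<in> U2. conj_invariant W} \<and>
      (U1 = U2 \<or> U1 = (\<lambda>W. cnj ` W) ` U2)"
    if "ultrafilter_on A U1" "ultrafilter_on A U2" "ultrafilter_ideal A U1 = ultrafilter_ideal A U2"
    for U1 U2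
  proof -
    have eq: "{W \<in> U1. conj_invariant W} = {W \<in> U2. conj_invariant W}"
      using filter[OF that(1)] filter[OF that(2)] that(3) by simp
    show ?thesis
      using ultrafilter_eq_or_conj_of_conj_invariant_members[OF A(3) that(1,2)] eq by blast
  qed
  moreover have "\<forall>W\<in>U. conj_invariant W \<longrightarrow> (\<exists>f\<in>carrier ?R. f 0 = 1 \<and> zero_set f = W)"
    using realise ultrafilter_onD(1)[OF U] by blast
  moreover have "{a \<in> A. one_plus_z_times H a = 0} = zero_set (one_plus_z_times H) \<and>
      (one_plus_z_times H \<in> ultrafilter_ideal A U \<longleftrightarrow> zero_set (one_plus_z_times H) \<in> U)"
    if "H \<in> carrier ?R" "zero_set (one_plus_z_times H) \<subseteq> A" for H
    using zeros[OF that(2)] mem[OF U that(2)] one_plus_z_times_mem[OF that(1)] by blast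
  ultimately show ?thesis
    using filter[OF U] contains field_ultraproduct[OF U] ring_hom_evaluation_hom[OF A(1) U]
    by (intro conjI) auto
qed

end
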